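(* Let $(L,\cdot,[,],\alpha,\beta)$ be a transposed BiHom-Poisson algebra over $K$. Then the following identities hold for all $x,y,z,h\in L$, where $\circlearrowleft_{x,y,z}$ denotes the sum over cyclic permutations of $x,y,z$ (with $h$ fixed): $$\circlearrowleft_{x,y,z}\alpha\beta^{2}(x)\cdot[\alpha\beta(y),\alpha^{2}(z)]=0;$$ $$\circlearrowleft_{x,y,z}[\alpha\beta^{2}(h)\cdot[\alpha\beta(x),\alpha^{2}(y)],\alpha^{3}\beta(z)]=0;$$ $$\circlearrowleft_{x,y,z}[[\alpha\beta^{2}(x),\alpha^{2}\beta(y)],\alpha^{2}\beta(z)\cdot\alpha^{3}(h)]=0;$$ $$\circlearrowleft_{x,y,z}[\alpha\beta^{3}(x),\alpha^{2}\beta^{2}(y)]\cdot[\alpha^{2}\beta(h),\alpha^{3}\beta(z)]=0.$$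
   Context: $K$ is a field of characteristic $0$; all vector spaces and linear maps are over $K$. A BiHom-commutative algebra $(L,\cdot,\alpha,\beta)$ is a vector space $L$ with a bilinear product $\cdot$ and linear maps $\alpha,\beta:L\to L$ such that for all $x,y,z$: $\alpha\circ\beta=\beta\circ\alpha$, $\alpha(x\cdot y)=\alpha(x)\cdot\alpha(y)$, $\beta(x\cdot y)=\beta(x)\cdot\beta(y)$, $\alpha(x)\cdot(y\cdot z)=(x\cdot y)\cdot\beta(z)$, and $\beta(x)\cdot\alpha(y)=\beta(y)\cdot\alpha(x)$. A BiHom-Lie algebra $(L,[,],\alpha,\beta)$ is a vector space $L$ with a bilinear bracket and commuting linear maps $\alpha,\beta:L\to L$ such that for all $x,y,z$: $\alpha([x,y])=[\alpha(x),\alpha(y)]$, $\beta([x,y])=[\beta(x),\beta(y)]$, $[\beta(x),\alpha(y)]=-[\beta(y),\alpha(x)]$, and $[[\beta(x),\alpha(y)],\alpha^2(z)]+[[\beta(y),\alpha(z)],\alpha^2(x)]+[[\beta(z),\alpha(x)],\alpha^2(y)]=0$. A transposed BiHom-Poisson algebra is a 5-tuple $(L,\cdot,[,],\alpha,\beta)$ such that $(L,\cdot,\alpha,\beta)$ is a BiHom-commutative algebra, $(L,[,],\alpha,\beta)$ is a BiHom-Lie algebra, and for all $x,y,z$: $2\alpha\beta(x)\cdot[y,z]=[\beta(x)\cdot y,\beta(z)]+[\beta(y),\alpha(x)\cdot z]$. *)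

theory Defs
  imports Complex_Main
begin

definition bilinear_op ::
  "('k::field \<Rightarrow> 'v::ab_group_add \<Rightarrow> 'v) \<Rightarrow> ('v \<Rightarrow> 'v \<Rightarrow> 'v) \<Rightarrow> bool" where
  "bilinear_op scale f \<longleftrightarrow>
     (\<forall>x. Vector_Spaces.linear scale scale (\<lambda>y. f x y)) \<and>
     (\<forall>y. Vector_Spaces.linear scale scale (\<lambda>x. f x y))"

definition cyclic_sum ::
  "('v \<Rightarrow> 'v \<Rightarrow> 'v \<Rightarrow> 'w::ab_group_add) \<Rightarrow> 'v \<Rightarrow> 'v \<Rightarrow> 'v \<Rightarrow> 'w" where
  "cyclic_sum F x y z = F x y z + F y z x + F z x y"

text \<open>In the locales below the underlying vector space is the whole type \<open>'v\<close>. The structure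
  maps \<open>\<alpha>\<close> and \<open>\<beta>\<close> need not be injective or surjective.\<close>

locale bihom_commutative_algebra = vector_space scale
  for scale :: "'k::field_char_0 \<Rightarrow> 'v::ab_group_add \<Rightarrow> 'v" +
  fixes mul :: "'v \<Rightarrow> 'v \<Rightarrow> 'v" (infixl "\<cdot>" 70)
    and \<alpha> \<beta> :: "'v \<Rightarrow> 'v"
  assumes bilinear_mul: "bilinear_op scale (\<cdot>)"
    and linear_alpha: "Vector_Spaces.linear scale scale \<alpha>"
    and linear_beta: "Vector_Spaces.linear scale scale \<beta>"
    and alpha_beta_comm: "\<alpha> \<circ> \<beta> = \<beta> \<circ> \<alpha>"
    and alpha_mul: "\<alpha> (x \<cdot> y) = \<alpha> x \<cdot> \<alpha> y"
    and beta_mul: "\<beta> (x \<cdot> y) = \<beta> x \<cdot> \<beta> y"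
    and bihom_assoc: "\<alpha> x \<cdot> (y \<cdot> z) = (x \<cdot> y) \<cdot> \<beta> z"
    and bihom_comm: "\<beta> x \<cdot> \<alpha> y = \<beta> y \<cdot> \<alpha> x"

locale bihom_lie_algebra = vector_space scale
  for scale :: "'k::field_char_0 \<Rightarrow> 'v::ab_group_add \<Rightarrow> 'v" +
  fixes bracket :: "'v \<Rightarrow> 'v \<Rightarrow> 'v" ("\<lbrace>_, _\<rbrace>")
    and \<alpha> \<beta> :: "'v \<Rightarrow> 'v"
  assumes bilinear_bracket: "bilinear_op scale bracket"
    and linear_alpha: "Vector_Spaces.linear scale scale \<alpha>"
    and linear_beta: "Vector_Spaces.linear scale scale \<beta>"
    and alpha_beta_comm: "\<alpha> \<circ> \<beta> = \<beta> \<circ> \<alpha>"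
    and alpha_bracket: "\<alpha> \<lbrace>x, y\<rbrace> = \<lbrace>\<alpha> x, \<alpha> y\<rbrace>"
    and beta_bracket: "\<beta> \<lbrace>x, y\<rbrace> = \<lbrace>\<beta> x, \<beta> y\<rbrace>"
    and bihom_skew: "\<lbrace>\<beta> x, \<alpha> y\<rbrace> = - \<lbrace>\<beta> y, \<alpha> x\<rbrace>"
    and bihom_jacobi:
      "\<lbrace>\<lbrace>\<beta> x, \<alpha> y\<rbrace>, (\<alpha> ^^ 2) z\<rbrace> + \<lbrace>\<lbrace>\<beta> y, \<alpha> z\<rbrace>, (\<alpha> ^^ 2) x\<rbrace> + \<lbrace>\<lbrace>\<beta> z, \<alpha> x\<rbrace>, (\<alpha> ^^ 2) y\<rbrace> = 0"

locale transposed_bihom_poisson_algebra =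
  com: bihom_commutative_algebra scale mul \<alpha> \<beta> +
  lie: bihom_lie_algebra scale bracket \<alpha> \<beta>
  for scale :: "'k::field_char_0 \<Rightarrow> 'v::ab_group_add \<Rightarrow> 'v"
    and mul :: "'v \<Rightarrow> 'v \<Rightarrow> 'v" (infixl "\<cdot>" 70)
    and bracket :: "'v \<Rightarrow> 'v \<Rightarrow> 'v" ("\<lbrace>_, _\<rbrace>")
    and \<alpha> \<beta> :: "'v \<Rightarrow> 'v" +
  assumes transposed_leibniz:
    "scale 2 (\<alpha> (\<beta> x) \<cdot> \<lbrace>y, z\<rbrace>) = \<lbrace>\<beta> x \<cdot> y, \<beta> z\<rbrace> + \<lbrace>\<beta> y, \<alpha> x \<cdot> z\<rbrace>"

end

theory Submission
  imports Defs
begin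

text \<open>
  In the classical case \<open>\<alpha> = \<beta> = id\<close> the argument runs as follows. Write \<open>J\<close> for a cyclic sum
  over \<open>x, y, z\<close>, and use the transposed Leibniz rule \<open>2 h[x,y] = [hx,y] + [x,hy]\<close>.

  \<^item> In \<open>2 J(x[y,z]) = J([xy,z] + [y,xz])\<close> the terms cancel in pairs, because the product is
    commutative and the bracket is skew.
  \<^item> Let \<open>P = J([h[x,y],z])\<close> and \<open>Q = J([[x,y],zh])\<close>. Multiplying the Jacobi identity by \<open>2h\<close> and
    distributing gives \<open>P + Q = 0\<close>. Summing the Jacobi identities for the triples \<open>x, y, zh\<close> and
    collecting the inner brackets with the Leibniz rule gives \<open>Q + 2P = 0\<close>. Hence
    \<open>P = Q = 0\<close>.
  \<^item> Finally \<open>2[x,y][h,z] = [[x,y]h,z] + [h,[x,y]z]\<close>, whose cyclic sum is \<open>P\<close> plus the bracket of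
    \<open>h\<close> with the first sum.

  If \<open>\<alpha>\<close> and \<open>\<beta>\<close> were bijective, the twisted statement would follow by untwisting both operations.
  They need not even be injective, so the argument is carried out in the twisted
  setting. The twisted laws apply only to elements such as \<open>\<beta> u\<close> and \<open>\<alpha> v\<close> that already lie in the
  image of a structure map, and the exponents in the four identities leave just enough
  room: at each step, every factor to be exchanged carries the \<open>\<alpha>\<close> or \<open>\<beta>\<close> which the law requires.
\<close>

context transposed_bihom_poisson_algebra
begin

lemma beta_alpha: "\<beta> (\<alpha> x) = \<alpha> (\<beta> x)"
  using com.alpha_beta_comm by (metis comp_apply)

lemma alpha_add: "\<alpha> (x + y) = \<alpha> x + \<alpha> y"
  and alpha_zero: "\<alpha> 0 = 0"
  using com.linear_alpha by (simp_all add: linear_iff_module_hom module_hom.add module_hom.zero)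

lemma linear_mul_right: "Vector_Spaces.linear scale scale (\<lambda>y. x \<cdot> y)"
  and linear_bracket_right: "Vector_Spaces.linear scale scale (\<lambda>y. \<lbrace>x, y\<rbrace>)"
  and linear_bracket_left: "Vector_Spaces.linear scale scale (\<lambda>x. \<lbrace>x, y\<rbrace>)"
  using com.bilinear_mul lie.bilinear_bracket by (simp_all add: bilinear_op_def)

lemmas mul_add_right = module_hom.add[OF linear_mul_right[unfolded linear_iff_module_hom]]
  and mul_zero_right = module_hom.zero[OF linear_mul_right[unfolded linear_iff_module_hom]]
  and bracket_add_right = module_hom.add[OF linear_bracket_right[unfolded linear_iff_module_hom]]
  and bracket_zero_right = module_hom.zero[OF linear_bracket_right[unfolded linear_iff_module_hom]]
  and bracket_add_left = module_hom.add[OF linear_bracket_left[unfolded linear_iff_module_hom]]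
  and bracket_scale_left = module_hom.scale[OF linear_bracket_left[unfolded linear_iff_module_hom]]

lemmas unfold_twists = numeral_2_eq_2 numeral_3_eq_3 beta_alpha com.alpha_mul com.beta_mul
  lie.alpha_bracket lie.beta_bracket

lemma scale_two: "scale 2 u = u + u"
  using com.scale_left_distrib[of 1 1 u] by simp

lemma scale_two_eq_0_iff: "scale 2 u = 0 \<longleftrightarrow> u = 0"
  by simp

text \<open>The Leibniz rule turns twice the sum into six terms \<open>\<lbrace>\<beta>\<^sup>2 u \<cdot> \<alpha>\<beta> v, \<alpha>\<^sup>2\<beta> w\<rbrace>\<close>, one for each ordering
  of \<open>x, y, z\<close> and with the sign of that ordering; as they are symmetric in \<open>u\<close> and \<open>v\<close>, they cancel
  in pairs.\<close>

lemma cyclic_mul_bracket: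
  "cyclic_sum (\<lambda>x y z. \<alpha> ((\<beta> ^^ 2) x) \<cdot> \<lbrace>\<alpha> (\<beta> y), (\<alpha> ^^ 2) z\<rbrace>) x y z = 0"
proof -
  define A where "A u v w = \<lbrace>\<beta> (\<beta> u) \<cdot> \<alpha> (\<beta> v), \<alpha> (\<alpha> (\<beta> w))\<rbrace>" for u v w
  have A_sym: "A u v w = A v u w" for u v w
    using com.bihom_comm[of "\<beta> u" "\<beta> v"] by (simp add: A_def)
  have expand: "scale 2 (\<alpha> (\<beta> (\<beta> u)) \<cdot> \<lbrace>\<alpha> (\<beta> v), \<alpha> (\<alpha> w)\<rbrace>) = A u v w - A u w v" for u v w
    using transposed_leibniz[of "\<beta> u" "\<alpha> (\<beta> v)" "\<alpha> (\<alpha> w)"]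
      lie.bihom_skew[of "\<alpha> (\<beta> v)" "\<beta> u \<cdot> \<alpha> w"]
    by (simp add: A_def unfold_twists)
  have "scale 2 (cyclic_sum (\<lambda>x y z. \<alpha> ((\<beta> ^^ 2) x) \<cdot> \<lbrace>\<alpha> (\<beta> y), (\<alpha> ^^ 2) z\<rbrace>) x y z) = 0"
    using A_sym[of x y z] A_sym[of y z x] A_sym[of z x y]
    by (simp add: cyclic_sum_def com.scale_right_distrib numeral_2_eq_2 expand)
  then show ?thesis
    by (simp only: scale_two_eq_0_iff)
qed

text \<open>Distributing \<open>2\<alpha>\<^sup>2\<beta>\<^sup>2 h\<close> over the three double brackets of a Jacobi identity.\<close>

lemma cyclic_jacobi_multiplied:
  "cyclic_sum (\<lambda>x y z. \<lbrace>\<alpha> ((\<beta> ^^ 2) h) \<cdot> \<lbrace>\<alpha> (\<beta> x), (\<alpha> ^^ 2) y\<rbrace>, (\<alpha> ^^ 3) (\<beta> z)\<rbrace>) x y z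
   + cyclic_sum (\<lambda>x y z. \<lbrace>\<lbrace>\<alpha> ((\<beta> ^^ 2) x), (\<alpha> ^^ 2) (\<beta> y)\<rbrace>, (\<alpha> ^^ 2) (\<beta> z) \<cdot> (\<alpha> ^^ 3) h\<rbrace>) x y z = 0"
proof -
  define D where "D u v w = \<lbrace>\<lbrace>\<alpha> (\<beta> u), \<alpha> (\<alpha> v)\<rbrace>, \<alpha> (\<alpha> (\<alpha> w))\<rbrace>" for u v w
  define P where "P u v w = \<lbrace>\<alpha> (\<beta> (\<beta> h)) \<cdot> \<lbrace>\<alpha> (\<beta> u), \<alpha> (\<alpha> v)\<rbrace>, \<alpha> (\<alpha> (\<alpha> (\<beta> w)))\<rbrace>" for u v w
  define Q where
    "Q u v w = \<lbrace>\<lbrace>\<alpha> (\<beta> (\<beta> u)), \<alpha> (\<alpha> (\<beta> v))\<rbrace>, \<alpha> (\<alpha> (\<beta> w)) \<cdot> \<alpha> (\<alpha> (\<alpha> h))\<rbrace>" for u v w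
  have distribute: "P u v w + Q u v w = scale 2 (\<alpha> (\<alpha> (\<beta> (\<beta> h))) \<cdot> D u v w)" for u v w
    using transposed_leibniz[of "\<alpha> (\<beta> h)" "\<lbrace>\<alpha> (\<beta> u), \<alpha> (\<alpha> v)\<rbrace>" "\<alpha> (\<alpha> (\<alpha> w))"]
      com.bihom_comm[of "\<alpha> (\<alpha> h)" "\<alpha> (\<alpha> w)"]
    by (simp add: P_def Q_def D_def unfold_twists)
  have jacobi: "D x y z + D y z x + D z x y = 0"
    using lie.bihom_jacobi[of "\<alpha> x" "\<alpha> y" "\<alpha> z"] by (simp add: D_def unfold_twists)
  have "(P x y z + Q x y z) + (P y z x + Q y z x) + (P z x y + Q z x y)
      = scale 2 (\<alpha> (\<alpha> (\<beta> (\<beta> h))) \<cdot> (D x y z + D y z x + D z x y))"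
    by (simp only: distribute mul_add_right com.scale_right_distrib)
  also have "\<dots> = 0"
    by (simp add: jacobi mul_zero_right)
  finally show ?thesis
    by (simp add: cyclic_sum_def P_def Q_def unfold_twists algebra_simps)
qed

text \<open>The Jacobi identities for the triples \<open>\<alpha>\<beta> u, \<alpha>\<beta> v, \<beta> w \<cdot> \<alpha> h\<close> are summed. In each of them the
  product sits once in the outer bracket; the other two terms, regrouped across
  the three identities, pair up inside an outer bracket with the same \<open>\<alpha>\<^sup>3\<beta> w\<close> to the
  two summands of the Leibniz rule.\<close>

lemma cyclic_jacobi_with_product:
  "cyclic_sum (\<lambda>x y z. \<lbrace>\<lbrace>\<alpha> ((\<beta> ^^ 2) x), (\<alpha> ^^ 2) (\<beta> y)\<rbrace>, (\<alpha> ^^ 2) (\<beta> z) \<cdot> (\<alpha> ^^ 3) h\<rbrace>) x y z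
   + scale 2 (cyclic_sum
      (\<lambda>x y z. \<lbrace>\<alpha> ((\<beta> ^^ 2) h) \<cdot> \<lbrace>\<alpha> (\<beta> x), (\<alpha> ^^ 2) y\<rbrace>, (\<alpha> ^^ 3) (\<beta> z)\<rbrace>) x y z) = 0"
proof -
  define P where "P u v w = \<lbrace>\<alpha> (\<beta> (\<beta> h)) \<cdot> \<lbrace>\<alpha> (\<beta> u), \<alpha> (\<alpha> v)\<rbrace>, \<alpha> (\<alpha> (\<alpha> (\<beta> w)))\<rbrace>" for u v w
  define Q where
    "Q u v w = \<lbrace>\<lbrace>\<alpha> (\<beta> (\<beta> u)), \<alpha> (\<alpha> (\<beta> v))\<rbrace>, \<alpha> (\<alpha> (\<beta> w)) \<cdot> \<alpha> (\<alpha> (\<alpha> h))\<rbrace>" for u v w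
  define R where
    "R u v w = \<lbrace>\<lbrace>\<beta> (\<beta> u) \<cdot> \<alpha> (\<beta> h), \<alpha> (\<alpha> (\<beta> v))\<rbrace>, \<alpha> (\<alpha> (\<alpha> (\<beta> w)))\<rbrace>" for u v w
  define S where
    "S u v w = \<lbrace>\<lbrace>\<alpha> (\<beta> (\<beta> u)), \<alpha> (\<beta> v) \<cdot> \<alpha> (\<alpha> h)\<rbrace>, \<alpha> (\<alpha> (\<alpha> (\<beta> w)))\<rbrace>" for u v w
  have jacobi: "Q u v w + S v w u + R w u v = 0" for u v w
    using lie.bihom_jacobi[of "\<alpha> (\<beta> u)" "\<alpha> (\<beta> v)" "\<beta> w \<cdot> \<alpha> h"]
    by (simp add: Q_def R_def S_def unfold_twists)
  have collect: "R u v w + S u v w = scale 2 (P u v w)" for u v w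
    using arg_cong[OF transposed_leibniz[of "\<beta> h" "\<alpha> (\<beta> u)" "\<alpha> (\<alpha> v)"],
        of "\<lambda>t. \<lbrace>t, \<alpha> (\<alpha> (\<alpha> (\<beta> w)))\<rbrace>"]
      com.bihom_comm[of "\<beta> h" "\<beta> u"] com.bihom_comm[of "\<alpha> h" "\<alpha> v"]
    by (simp add: P_def R_def S_def beta_alpha bracket_add_left bracket_scale_left)
  have "(Q x y z + Q y z x + Q z x y) + scale 2 (P x y z + P y z x + P z x y)
      = (Q x y z + S y z x + R z x y) + (Q y z x + S z x y + R x y z)
        + (Q z x y + S x y z + R y z x)"
    by (simp only: com.scale_right_distrib collect[symmetric]) (simp only: ac_simps)
  also have "\<dots> = 0"
    by (simp only: jacobi add_0_left)
  finally show ?thesis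
    by (simp add: cyclic_sum_def P_def Q_def unfold_twists)
qed

lemma solve_system:
  assumes "p + q = 0" and "q + scale 2 p = 0"
  shows "p = 0" and "q = 0"
proof -
  have "p = (q + scale 2 p) - (p + q)"
    by (simp add: scale_two)
  then show "p = 0"
    using assms by simp
  then show "q = 0"
    using assms by simp
qed

lemma cyclic_bracket_of_mul_bracket:
  "cyclic_sum (\<lambda>x y z. \<lbrace>\<alpha> ((\<beta> ^^ 2) h) \<cdot> \<lbrace>\<alpha> (\<beta> x), (\<alpha> ^^ 2) y\<rbrace>, (\<alpha> ^^ 3) (\<beta> z)\<rbrace>) x y z = 0"
  and cyclic_bracket_bracket_mul:
  "cyclic_sum (\<lambda>x y z. \<lbrace>\<lbrace>\<alpha> ((\<beta> ^^ 2) x), (\<alpha> ^^ 2) (\<beta> y)\<rbrace>, (\<alpha> ^^ 2) (\<beta> z) \<cdot> (\<alpha> ^^ 3) h\<rbrace>) x y z = 0"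
  using solve_system[OF cyclic_jacobi_multiplied cyclic_jacobi_with_product] by blast+

text \<open>The Leibniz rule, with the bracket of \<open>x\<close> and \<open>y\<close> as the factor outside, splits each product into
  two terms. BiHom-commutativity moves that inner bracket to the right of \<open>h\<close> in one of them and to
  the right of \<open>z\<close> in the other. The former sum is an instance, at \<open>\<beta> x, \<beta> y, \<beta> z\<close>, of
  an identity already proved, and the latter is \<open>\<lbrace>\<alpha>\<^sup>2\<beta>\<^sup>2 h, \<alpha> s\<rbrace>\<close> for a vanishing cyclic sum \<open>s\<close>.\<close>

lemma cyclic_mul_of_brackets:
  "cyclic_sum (\<lambda>x y z.
     \<lbrace>\<alpha> ((\<beta> ^^ 3) x), (\<alpha> ^^ 2) ((\<beta> ^^ 2) y)\<rbrace> \<cdot> \<lbrace>(\<alpha> ^^ 2) (\<beta> h), (\<alpha> ^^ 3) (\<beta> z)\<rbrace>) x y z = 0"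
proof -
  define B where "B u v w =
    \<lbrace>\<alpha> (\<beta> (\<beta> (\<beta> u))), \<alpha> (\<alpha> (\<beta> (\<beta> v)))\<rbrace> \<cdot> \<lbrace>\<alpha> (\<alpha> (\<beta> h)), \<alpha> (\<alpha> (\<alpha> (\<beta> w)))\<rbrace>" for u v w
  define P where "P u v w = \<lbrace>\<alpha> (\<beta> (\<beta> h)) \<cdot> \<lbrace>\<alpha> (\<beta> u), \<alpha> (\<alpha> v)\<rbrace>, \<alpha> (\<alpha> (\<alpha> (\<beta> w)))\<rbrace>" for u v w
  define M where "M u v w = \<alpha> (\<beta> (\<beta> u)) \<cdot> \<lbrace>\<alpha> (\<beta> v), \<alpha> (\<alpha> w)\<rbrace>" for u v w
  have expand:
    "scale 2 (B u v w) = P (\<beta> u) (\<beta> v) (\<beta> w) + \<lbrace>\<alpha> (\<alpha> (\<beta> (\<beta> h))), \<alpha> (M w u v)\<rbrace>" for u v w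
    using transposed_leibniz[of "\<lbrace>\<beta> (\<beta> u), \<alpha> (\<beta> v)\<rbrace>" "\<alpha> (\<alpha> (\<beta> h))" "\<alpha> (\<alpha> (\<alpha> (\<beta> w)))"]
      com.bihom_comm[of "\<lbrace>\<beta> (\<beta> u), \<alpha> (\<beta> v)\<rbrace>" "\<alpha> (\<beta> h)"]
      com.bihom_comm[of "\<lbrace>\<alpha> (\<beta> u), \<alpha> (\<alpha> v)\<rbrace>" "\<alpha> (\<alpha> (\<beta> w))"]
    by (simp add: B_def P_def M_def unfold_twists)
  have P_sum: "P (\<beta> x) (\<beta> y) (\<beta> z) + P (\<beta> y) (\<beta> z) (\<beta> x) + P (\<beta> z) (\<beta> x) (\<beta> y) = 0"
    using cyclic_bracket_of_mul_bracket[of h "\<beta> x" "\<beta> y" "\<beta> z"]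
    by (simp add: cyclic_sum_def P_def unfold_twists)
  have M_sum: "M z x y + M x y z + M y z x = 0"
    using cyclic_mul_bracket[of z x y] by (simp add: cyclic_sum_def M_def unfold_twists)
  have "scale 2 (B x y z + B y z x + B z x y)
      = (P (\<beta> x) (\<beta> y) (\<beta> z) + P (\<beta> y) (\<beta> z) (\<beta> x) + P (\<beta> z) (\<beta> x) (\<beta> y))
        + \<lbrace>\<alpha> (\<alpha> (\<beta> (\<beta> h))), \<alpha> (M z x y + M x y z + M y z x)\<rbrace>"
    by (simp add: com.scale_right_distrib expand bracket_add_right alpha_add)
  also have "\<dots> = 0"
    by (simp add: P_sum M_sum alpha_zero bracket_zero_right)
  finally show ?thesis
    by (simp only: scale_two_eq_0_iff) (simp add: cyclic_sum_def B_def unfold_twists)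
qed

end

theorem theorem2p5:
  fixes scale :: "'k::field_char_0 \<Rightarrow> 'v::ab_group_add \<Rightarrow> 'v"
    and mul :: "'v \<Rightarrow> 'v \<Rightarrow> 'v" (infixl "\<cdot>" 70)
    and bracket :: "'v \<Rightarrow> 'v \<Rightarrow> 'v" ("\<lbrace>_, _\<rbrace>")
    and \<alpha> \<beta> :: "'v \<Rightarrow> 'v"
    and x y z h :: 'v
  assumes "transposed_bihom_poisson_algebra scale mul bracket \<alpha> \<beta>"
  shows
    "cyclic_sum (\<lambda>x y z. \<alpha> ((\<beta> ^^ 2) x) \<cdot> \<lbrace>\<alpha> (\<beta> y), (\<alpha> ^^ 2) z\<rbrace>) x y z = 0 \<and>
     cyclic_sum (\<lambda>x y z.
       \<lbrace>\<alpha> ((\<beta> ^^ 2) h) \<cdot> \<lbrace>\<alpha> (\<beta> x), (\<alpha> ^^ 2) y\<rbrace>, (\<alpha> ^^ 3) (\<beta> z)\<rbrace>) x y z = 0 \<and>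
     cyclic_sum (\<lambda>x y z.
       \<lbrace>\<lbrace>\<alpha> ((\<beta> ^^ 2) x), (\<alpha> ^^ 2) (\<beta> y)\<rbrace>, (\<alpha> ^^ 2) (\<beta> z) \<cdot> (\<alpha> ^^ 3) h\<rbrace>) x y z = 0 \<and>
     cyclic_sum (\<lambda>x y z.
       \<lbrace>\<alpha> ((\<beta> ^^ 3) x), (\<alpha> ^^ 2) ((\<beta> ^^ 2) y)\<rbrace> \<cdot> \<lbrace>(\<alpha> ^^ 2) (\<beta> h), (\<alpha> ^^ 3) (\<beta> z)\<rbrace>) x y z = 0"
proof -
  interpret transposed_bihom_poisson_algebra scale mul bracket \<alpha> \<beta>
    by (fact assms)
  show ?thesis
    using cyclic_mul_bracket cyclic_bracket_of_mul_bracket cyclic_bracket_bracket_mul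
      cyclic_mul_of_brackets
    by blast
qed

end
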